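(* Let $n\ge 2$ be an integer. The infinite $n$-regular tree $\mathcal{T}_n$ is a distance-regular graph with intersection array $(n,n-1,n-1,n-1,\dots;1,1,1,1,\dots)$, i.e. $b_0=n$, $b_1=b_2=b_3=\cdots=n-1$, $c_1=c_2=c_3=\cdots=1$.
   Context: The infinite $n$-regular tree $\mathcal{T}_n$ is the connected infinite simple graph without cycles in which every vertex has degree $n$ (unique up to isomorphism). For a connected simple graph $X=(V,E)$ with graph distance $d$, let $\Gamma_i(v)=\{w\in V:d(v,w)=i\}$ and let $\mathrm{diam}(X)\in\mathbb{N}_0\cup\{\infty\}$ be the supremum of distances. $X$ is distance-regular with intersection array $(b_0,b_1,\dots;c_1,c_2,\dots)$ (positive integers) if: $|\Gamma_1(v)|=b_0$ for all $v\in V$; for each $1\le i<\mathrm{diam}(X)$ and all $v,w\in V$ with $d(v,w)=i$, $|\Gamma_{i+1}(v)\cap\Gamma_1(w)|=b_i$ and $|\Gamma_{i-1}(v)\cap\Gamma_1(w)|=c_i$; and, if $s=\mathrm{diam}(X)<\infty$, $|\Gamma_{s-1}(v)\cap\Gamma_1(w)|=c_s$ whenever $d(v,w)=s$. *)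

theory Defs
  imports "Graph_Theory.Graph_Theory"
begin

text \<open>
  A simple graph, possibly infinite, is a symmetric loop-free digraph whose arcs are ordered
  pairs of vertices (\<^locale>\<open>pair_bidirected_digraph\<close>); every undirected edge is
  represented by its two orientations.
\<close>

text \<open>
  In a symmetric digraph every edge traversed back and forth is a \<^const>\<open>pre_digraph.cycle\<close>
  of length 2. The cycles of the undirected graph are exactly those of length at least 3.
\<close>

definition acyclic_graph :: "'a pair_pre_digraph \<Rightarrow> bool" where
  "acyclic_graph G \<longleftrightarrow> (\<nexists>p. pre_digraph.cycle (with_proj G) p \<and> 3 \<le> length p)"

definition infinite_regular_tree :: "nat \<Rightarrow> 'a pair_pre_digraph \<Rightarrow> bool" where
  "infinite_regular_tree n G \<longleftrightarrow>
     pair_bidirected_digraph G \<and> infinite (pverts G) \<and>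
     connected (with_proj G) \<and> acyclic_graph G \<and>
     (\<forall>v\<in>pverts G. finite (out_arcs (with_proj G) v) \<and> out_degree (with_proj G) v = n)"

definition graph_dist :: "'a pair_pre_digraph \<Rightarrow> 'a \<Rightarrow> 'a \<Rightarrow> ereal" where
  "graph_dist G u v = wf_digraph.\<mu> (with_proj G) (\<lambda>_. 1) u v"

definition graph_sphere :: "'a pair_pre_digraph \<Rightarrow> nat \<Rightarrow> 'a \<Rightarrow> 'a set" where
  "graph_sphere G i v = {w \<in> pverts G. graph_dist G v w = ereal (real i)}"

definition graph_diam :: "'a pair_pre_digraph \<Rightarrow> ereal" where
  "graph_diam G = (SUP (u, v) \<in> pverts G \<times> pverts G. graph_dist G u v)"

text \<open>
  The intersection array is \<open>(b 0, b 1, \<dots>; c 1, c 2, \<dots>)\<close>; the value \<open>c 0\<close> is irrelevant,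
  as are \<open>b i\<close> for \<open>i \<ge> max 1 s\<close> and \<open>c i\<close> for \<open>i > s\<close> when the diameter \<open>s\<close> is finite. Since
  the functions \<open>b\<close> and \<open>c\<close> do not record the length of the array, having an infinite array
  additionally means \<open>graph_diam G = \<infinity>\<close>.
\<close>

definition distance_regular ::
    "'a pair_pre_digraph \<Rightarrow> (nat \<Rightarrow> nat) \<Rightarrow> (nat \<Rightarrow> nat) \<Rightarrow> bool" where
  "distance_regular G b c \<longleftrightarrow>
     pair_bidirected_digraph G \<and> connected (with_proj G) \<and>
     0 < b 0 \<and>
     (\<forall>i. 1 \<le> i \<and> ereal (real i) < graph_diam G \<longrightarrow> 0 < b i) \<and>
     (\<forall>i. 1 \<le> i \<and> ereal (real i) \<le> graph_diam G \<longrightarrow> 0 < c i) \<and>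
     (\<forall>v\<in>pverts G. card (graph_sphere G 1 v) = b 0) \<and>
     (\<forall>i. 1 \<le> i \<and> ereal (real i) < graph_diam G \<longrightarrow>
        (\<forall>v\<in>pverts G. \<forall>w\<in>pverts G. graph_dist G v w = ereal (real i) \<longrightarrow>
           card (graph_sphere G (i + 1) v \<inter> graph_sphere G 1 w) = b i \<and>
           card (graph_sphere G (i - 1) v \<inter> graph_sphere G 1 w) = c i)) \<and>
     (\<forall>s. 1 \<le> s \<and> graph_diam G = ereal (real s) \<longrightarrow>
        (\<forall>v\<in>pverts G. \<forall>w\<in>pverts G. graph_dist G v w = ereal (real s) \<longrightarrow>
           card (graph_sphere G (s - 1) v \<inter> graph_sphere G 1 w) = c s))"

end

theory Submission
  imports Defs
begin

text \<open>
  In an acyclic graph two vertices are joined by at most one path, since two paths that diverge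
  would enclose a cycle between the point of divergence and the next common vertex. Hence in a tree
  the distance of \<open>v\<close> and \<open>w\<close> is the length of the path between them. Of the neighbours of
  \<open>w \<noteq> v\<close>, exactly one lies on this path, namely the predecessor of \<open>w\<close>, and every other one
  extends the path by one step.
\<close>

section \<open>Forests: uniqueness of paths, and distance as path length\<close>

locale pair_forest = pair_bidirected_digraph +
  assumes acyclic: "acyclic_graph G"

text \<open>Acyclicity alone yields uniqueness of paths; connectedness is added here to yield their
  existence.\<close>

locale pair_tree = pair_forest +
  assumes conn: "connected (with_proj G)"

text \<open>Stopping a walk at the first vertex that lies in \<open>S\<close> gives
  \<open>p1\<close>; the \<open>butlast\<close> exempts only the hit \<open>x\<close> itself. This
  locates the first vertex where one path meets another again.\<close>

lemma (in pair_wf_digraph) awalk_first_hit: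
  assumes "awalk u p v" "v \<in> S"
  obtains p1 p2 x where "p = p1 @ p2" "awalk u p1 x" "x \<in> S"
    "set (butlast (awalk_verts u p1)) \<inter> S = {}"
proof -
  have "\<exists>p1 p2 x. p = p1 @ p2 \<and> awalk u p1 x \<and> x \<in> S \<and>
      set (butlast (awalk_verts u p1)) \<inter> S = {}"
    using assms(1)
  proof (induct p arbitrary: u)
    case Nil
    then show ?case using assms(2) by (auto simp: awalk_Nil_iff)
  next
    case (Cons e p)
    show ?case
    proof (cases "u \<in> S")
      case True
      moreover have "u \<in> pverts G" using Cons.prems by (rule awalk_hd_in_verts)
      ultimately show ?thesis
        by (intro exI[of _ "[]"] exI[of _ "e # p"] exI[of _ u]) (auto simp: awalk_Nil_iff)
    next
      case False
      have e: "e \<in> parcs G" "u = fst e" "awalk (snd e) p v"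
        using Cons.prems by (auto simp: awalk_Cons_iff)
      obtain p1 p2 x where "p = p1 @ p2" "awalk (snd e) p1 x" "x \<in> S"
        "set (butlast (awalk_verts (snd e) p1)) \<inter> S = {}"
        using Cons.hyps[OF e(3)] by blast
      with e False show ?thesis
        by (intro exI[of _ "e # p1"] exI[of _ p2] exI[of _ x]) (auto simp: awalk_Cons_iff)
    qed
  qed
  then show ?thesis using that by blast
qed

lemma (in pair_wf_digraph) apath_split_at:
  assumes "apath u p v" "x \<in> set (awalk_verts u p)"
  obtains p1 p2 where "p = p1 @ p2" "apath u p1 x" "apath x p2 v"
proof -
  obtain p1 p2 where p: "p = p1 @ p2" "awalk u p1 x" "awalk x p2 v"
    using awalk_decomp[of u p v x] assms by (auto simp: apath_def)
  then have "awlast u p1 = x" by auto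
  with p assms(1) show ?thesis by (intro that[of p1 p2]) (auto simp: apath_append_iff)
qed

text \<open>Induction on the first path: a common first arc is stripped, and distinct first arcs
  \<open>e\<close>, \<open>f\<close> are refuted by building a cycle through
  \<open>e\<close>.\<close>

lemma (in pair_forest) apath_unique:
  assumes "apath u p v" "apath u q v"
  shows "p = q"
  using assms
proof (induct p arbitrary: u q)
  case Nil
  then show ?case using apath_nonempty_ends[of u q v] by (auto simp: apath_Nil_iff)
next
  case (Cons e p)
  have "q \<noteq> []"
    using Cons.prems apath_nonempty_ends[of u "e # p" v] by (auto simp: apath_Nil_iff)
  then obtain f q' where q: "q = f # q'" by (cases q) auto
  have e: "e \<in> parcs G" "fst e = u" "apath (snd e) p v" "u \<notin> set (awalk_verts (snd e) p)"
    using Cons.prems(1) by (auto simp: apath_Cons_iff)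
  have f: "fst f = u" "apath (snd f) q' v"
    using Cons.prems(2) q by (auto simp: apath_Cons_iff)
  show ?case
  proof (cases "e = f")
    case True
    with Cons.hyps e f q show ?thesis by simp
  next
    case False
    \<comment> \<open>After \<open>e\<close>, the first path must return to \<open>q\<close>, at the
      latest in \<open>v\<close>; \<open>x\<close> is the first such vertex.\<close>
    let ?S = "set (awalk_verts u q)"
    have "v \<in> ?S" using Cons.prems(2) by (auto simp: apath_def)
    moreover have "awalk (snd e) p v" using e by (simp add: apath_def)
    ultimately obtain p1 p2 x where p: "p = p1 @ p2" "awalk (snd e) p1 x" "x \<in> ?S"
      "set (butlast (awalk_verts (snd e) p1)) \<inter> ?S = {}"
      using awalk_first_hit[of "snd e" p v ?S] by blast
    obtain q1 q2 where q12: "q = q1 @ q2" "apath u q1 x" "apath x q2 v"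
      using apath_split_at[OF Cons.prems(2) p(3)] .
    have last_p1: "awlast (snd e) p1 = x" using p by auto
    \<comment> \<open>The cycle leaves \<open>u\<close> by \<open>e\<close>, follows
      \<open>p1\<close> to \<open>x\<close> and returns along \<open>q1\<close> reversed.\<close>
    have walk: "awalk (snd e) (p1 @ rev_path q1) u"
      using p(2) q12(2) by (auto intro!: awalk_appendI simp: apath_def)
    \<comment> \<open>The junction \<open>x\<close> belongs to both pieces; with
      \<open>butlast\<close> it is listed once, and by the choice of \<open>x\<close> the two lists
      are then disjoint.\<close>
    have "awalk_verts (snd e) (p1 @ rev_path q1)
        = butlast (awalk_verts (snd e) p1) @ rev (awalk_verts u q1)"
      using awalk_verts_append2[OF walk] q12(2) last_p1
      by (simp add: apath_def awalk_verts_rev_path)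
    moreover have "distinct (awalk_verts (snd e) p1)"
      using e(3) p(1) by (auto simp: apath_append_iff apath_def[of _ p1])
    moreover have "set (awalk_verts u q1) \<subseteq> ?S"
    proof -
      have "awalk u (q1 @ q2) v" using Cons.prems(2) q12(1) by (simp add: apath_def)
      then show ?thesis using awalk_verts_append[of u q1 q2 v] q12(1) by simp
    qed
    ultimately have "distinct (awalk_verts (snd e) (p1 @ rev_path q1))"
      using p(4) q12(2) by (auto simp: apath_def distinct_butlast)
    \<comment> \<open>\<open>cycle_def\<close> asks for distinctness only after the initial vertex
      \<open>u\<close>, that is, along the walk from \<open>snd e\<close>.\<close>
    with walk e(1,2) have "cycle (e # p1 @ rev_path q1)"
      unfolding cycle_def by (intro exI[of _ u]) (auto simp: awalk_Cons_iff)
    moreover have "3 \<le> length (e # p1 @ rev_path q1)"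
    \<comment> \<open>Since \<open>u\<close> is not on \<open>p\<close>, \<open>x\<close> differs
      from \<open>u\<close> and \<open>q1\<close> starts with \<open>f\<close>. Length below 3
      leaves only \<open>e\<close> followed by the reverse of \<open>f\<close>, so both run from
      \<open>u\<close> to \<open>x\<close> and coincide.\<close>
    proof (rule ccontr)
      assume short: "\<not> ?thesis"
      have "x \<in> set (awalk_verts (snd e) p)"
        using e(3) p(1) last_p1 awalk_verts_append[of "snd e" p1 p2 v]
          last_in_set[OF awalk_verts_non_Nil, of "snd e" p1]
        by (auto simp: apath_def)
      with e(4) have "q1 \<noteq> []" using q12(2) by (auto simp: apath_Nil_iff)
      then obtain r where r: "q1 = f # r" using q q12(1) by (cases q1) auto
      with short have "p1 = []" "r = []" by (auto simp: Suc_le_eq)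
      then have "snd e = x" "snd f = x"
        using p(2) q12(2) r by (auto simp: awalk_Nil_iff apath_Cons_iff apath_Nil_iff)
      with False e(2) f(1) show False by (simp add: prod_eq_iff)
    qed
    ultimately show ?thesis using acyclic by (auto simp: acyclic_graph_def)
  qed
qed

text \<open>With unit weights the cost of a walk is its length. Every walk from \<open>u\<close> to
  \<open>v\<close> reduces to a path, which is \<open>p\<close> by uniqueness, and removing cycles
  of nonnegative cost never raises the cost. So \<open>p\<close> attains the infimum.\<close>

lemma (in pair_forest) graph_dist_apath:
  assumes "apath u p v"
  shows "graph_dist G u v = ereal (real (length p))"
proof -
  have cost: "awalk_cost (\<lambda>_. 1) q = real (length q)" for q :: "('a \<times> 'a) awalk"
    by (induct q) auto
  have "length p \<le> length q" if q: "awalk u q v" for q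
  proof -
    have "awalk_to_apath q = p"
      using apath_awalk_to_apath[OF q] assms by (rule apath_unique)
    with awalk_to_path_no_neg_cyc_cost[OF q, of "\<lambda>_. 1"] show ?thesis by (simp add: cost)
  qed
  with assms show ?thesis
    unfolding graph_dist_def \<mu>_def by (intro antisym INF_greatest INF_lower2[of p])
      (auto simp: cost apath_def)
qed

section \<open>Trees: spheres, neighbours and diameter\<close>

context pair_tree
begin

lemma apathE:
  assumes "u \<in> pverts G" "v \<in> pverts G"
  obtains p where "apath u p v"
proof -
  \<comment> \<open>\<open>connected\<close> concerns the symmetric closure; as the arcs are already
    symmetric, it gives directed reachability.\<close>
  have "strongly_connected (with_proj G)"
    using symmetric_connected_imp_strongly_connected sym_arcs conn by blast
  with assms have "u \<rightarrow>\<^sup>*\<^bsub>with_proj G\<^esub> v" by (auto simp: strongly_connected_def)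
  then show ?thesis using that by (auto simp: reachable_apath)
qed

lemma graph_sphere_iff:
  assumes "v \<in> pverts G"
  shows "w \<in> graph_sphere G i v \<longleftrightarrow> (\<exists>p. apath v p w \<and> length p = i)"
proof
  assume "w \<in> graph_sphere G i v"
  then have w: "w \<in> pverts G" "graph_dist G v w = ereal (real i)"
    by (auto simp: graph_sphere_def)
  then obtain p where "apath v p w" using apathE assms by blast
  with w(2) show "\<exists>p. apath v p w \<and> length p = i" by (auto simp: graph_dist_apath)
qed (auto simp: graph_sphere_def graph_dist_apath apath_def)

lemma graph_sphere_0: "v \<in> pverts G \<Longrightarrow> graph_sphere G 0 v = {v}"
  by (auto simp: graph_sphere_iff apath_Nil_iff)

lemma graph_sphere_1:
  assumes "v \<in> pverts G"
  shows "graph_sphere G 1 v = {w. (v, w) \<in> parcs G}"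
proof -
  have "(\<exists>p. apath v p w \<and> length p = 1) \<longleftrightarrow> (v, w) \<in> parcs G" for w
  proof
    assume "\<exists>p. apath v p w \<and> length p = 1"
    then obtain e where "apath v [e] w" by (auto simp: length_Suc_conv)
    then show "(v, w) \<in> parcs G" by (cases e) (auto simp: apath_simps)
  next
    assume "(v, w) \<in> parcs G"
    then have "apath v [(v, w)] w" by (auto simp: apath_simps in_arcsD2 dest: no_loops')
    then show "\<exists>p. apath v p w \<and> length p = 1" by (intro exI[of _ "[(v, w)]"]) simp
  qed
  then show ?thesis using graph_sphere_iff[OF assms] by blast
qed

lemma card_graph_sphere_1:
  assumes "v \<in> pverts G"
  shows "card (graph_sphere G 1 v) = out_degree (with_proj G) v"
proof -
  have "out_arcs (with_proj G) v = Pair v ` graph_sphere G 1 v"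
    using assms by (auto simp: graph_sphere_1 simp del: One_nat_def)
  then show ?thesis by (simp add: out_degree_def card_image inj_on_def)
qed

text \<open>The path has length \<open>length p + 1\<close>, so the two radii are one below and one
  above the distance of \<open>w\<close> from \<open>v\<close>. The predecessor \<open>y\<close> is
  the only neighbour nearer to \<open>v\<close>; all others prolong the path.\<close>

lemma neighbours_of_apath_end:
  assumes "apath v (p @ [(y, w)]) w"
  shows "graph_sphere G (length p) v \<inter> graph_sphere G 1 w = {y}"
    and "graph_sphere G (length p + 2) v \<inter> graph_sphere G 1 w = graph_sphere G 1 w - {y}"
proof -
  have v: "v \<in> pverts G" and w: "w \<in> pverts G"
    using assms by (auto simp: apath_def)
  have py: "apath v p y" "(y, w) \<in> parcs G"
    using assms by (auto simp: apath_append_iff apath_simps)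
  have *: "x = y \<or> apath v (p @ [(y, w), (w, x)]) x" if x: "(w, x) \<in> parcs G" for x
  proof (cases "x \<in> set (awalk_verts v (p @ [(y, w)]))")
    case True
    \<comment> \<open>A neighbour \<open>x\<close> already on the path is joined to \<open>w\<close>
      both by the tail \<open>p2\<close> and by a single arc. Uniqueness equates the two, so
      \<open>x\<close> is the predecessor \<open>y\<close>.\<close>
    from apath_split_at[OF assms True] obtain p1 p2
      where p12: "p @ [(y, w)] = p1 @ p2" "apath v p1 x" "apath x p2 w" .
    have "apath x [(x, w)] w"
      using x by (auto simp: apath_simps in_arcsD1 arcs_symmetric dest: no_loops')
    with p12(3) have "p2 = [(x, w)]" by (rule apath_unique)
    with p12(1) show ?thesis by simp
  next
    case False
    have last: "awlast v (p @ [(y, w)]) = w" using assms by (auto simp: apath_def)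
    have "apath w [(w, x)] x"
      using x by (auto simp: apath_simps in_arcsD2 dest: no_loops')
    with assms False last have "apath v ((p @ [(y, w)]) @ [(w, x)]) x"
      by (subst apath_append_iff) simp
    then show ?thesis by simp
  qed
  \<comment> \<open>By uniqueness of paths each neighbour of \<open>w\<close> lies in exactly one
    sphere around \<open>v\<close>; \<open>dy\<close> and \<open>dx\<close> record which.\<close>
  have dy: "y \<in> graph_sphere G i v \<longleftrightarrow> i = length p" for i
    using graph_sphere_iff[OF v, of y i] py(1) apath_unique[OF py(1)] by blast
  have dx: "x \<in> graph_sphere G i v \<longleftrightarrow> i = length p + 2"
    if "(w, x) \<in> parcs G" "x \<noteq> y" for i x
  proof -
    have path: "apath v (p @ [(y, w), (w, x)]) x" using * that by blast
    have "length (p @ [(y, w), (w, x)]) = length p + 2" by simp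
    with path show ?thesis
      using graph_sphere_iff[OF v, of x i] apath_unique[OF path] by metis
  qed
  have wy: "(w, y) \<in> parcs G" using py(2) by (rule arcs_symmetric)
  show "graph_sphere G (length p) v \<inter> graph_sphere G 1 w = {y}"
    unfolding graph_sphere_1[OF w] using dx[of _ "length p"] dy[of "length p"] wy by auto
  show "graph_sphere G (length p + 2) v \<inter> graph_sphere G 1 w = graph_sphere G 1 w - {y}"
    unfolding graph_sphere_1[OF w] using dx[of _ "length p + 2"] dy[of "length p + 2"] by auto
qed

lemma card_sphere_inter_neighbours:
  assumes "v \<in> pverts G" "w \<in> graph_sphere G i v" "1 \<le> i"
  shows "card (graph_sphere G (i - 1) v \<inter> graph_sphere G 1 w) = 1"
    and "card (graph_sphere G (i + 1) v \<inter> graph_sphere G 1 w) = out_degree (with_proj G) w - 1"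
proof -
  obtain p where p: "apath v p w" "length p = i"
    using assms graph_sphere_iff by blast
  \<comment> \<open>As \<open>i\<close> is at least 1, the path has a last arc, whose tail
    \<open>y\<close> is the predecessor of \<open>w\<close>.\<close>
  then obtain q a where "p = q @ [a]" using assms(3) by (cases p rule: rev_cases) auto
  moreover from this have "snd a = w" using p(1) by (auto simp: apath_append_iff apath_simps)
  ultimately obtain y where q: "p = q @ [(y, w)]" by (cases a) auto
  have i: "i - 1 = length q" "i + 1 = length q + 2" using p(2) q by auto
  have w: "w \<in> pverts G" using p(1) by (auto simp: apath_def)
  note N = neighbours_of_apath_end[OF p(1)[unfolded q]]
  show "card (graph_sphere G (i - 1) v \<inter> graph_sphere G 1 w) = 1"
    unfolding i N by simp
  \<comment> \<open>Since \<open>y\<close> is itself a neighbour of \<open>w\<close>, removing it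
    lowers the degree by exactly one.\<close>
  have "y \<in> graph_sphere G 1 w" using N(1) by blast
  then show "card (graph_sphere G (i + 1) v \<inter> graph_sphere G 1 w)
      = out_degree (with_proj G) w - 1"
    unfolding i N by (simp add: card_graph_sphere_1[OF w, symmetric] card_Diff_singleton)
qed

text \<open>Degree at least 2 leaves, beside the predecessor, another neighbour to move on to, so
  paths from \<open>v\<close> can be prolonged forever.\<close>

lemma graph_sphere_nonempty:
  assumes deg: "\<And>w. w \<in> pverts G \<Longrightarrow> 2 \<le> out_degree (with_proj G) w"
    and v: "v \<in> pverts G"
  shows "graph_sphere G i v \<noteq> {}"
proof (induct i)
  case 0
  show ?case using v by (simp add: graph_sphere_0)
next
  case (Suc i)
  then obtain w where w: "w \<in> graph_sphere G i v" by blast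
  then have degw: "2 \<le> out_degree (with_proj G) w" using deg by (simp add: graph_sphere_def)
  show ?case
  \<comment> \<open>The centre \<open>v\<close> has no predecessor, so its neighbours are counted by
    the full degree instead of the degree minus one.\<close>
  proof (cases "i = 0")
    case True
    with w v have "w = v" by (simp add: graph_sphere_0)
    with True degw v show ?thesis using card_graph_sphere_1[OF v] by force
  next
    case False
    with card_sphere_inter_neighbours(2)[OF v w] degw
    have "card (graph_sphere G (i + 1) v \<inter> graph_sphere G 1 w) \<noteq> 0" by simp
    then have "graph_sphere G (i + 1) v \<inter> graph_sphere G 1 w \<noteq> {}" by (metis card.empty)
    then show ?thesis by auto
  qed
qed

text \<open>Spheres of every radius are inhabited, so the distances exceed every real bound.\<close>

lemma graph_diam_infinite:
  assumes deg: "\<And>w. w \<in> pverts G \<Longrightarrow> 2 \<le> out_degree (with_proj G) w"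
  shows "graph_diam G = \<infinity>"
proof (rule ereal_top)
  fix B :: real
  obtain i :: nat where i: "B \<le> real i" using real_arch_simple by blast
  have "pverts G \<noteq> {}" using conn by (simp add: connected_conv)
  then obtain v where v: "v \<in> pverts G" by blast
  then obtain w where "w \<in> graph_sphere G i v" using graph_sphere_nonempty[OF deg] by blast
  then have w: "w \<in> pverts G" "graph_dist G v w = ereal (real i)"
    by (auto simp: graph_sphere_def)
  have "graph_dist G v w \<le> graph_diam G"
    unfolding graph_diam_def using v w(1) by (intro SUP_upper2[of "(v, w)"]) auto
  with i w(2) show "ereal B \<le> graph_diam G" by (metis ereal_less_eq(3) order_trans)
qed

end

theorem proposition3p6:
  fixes n :: nat and T :: "'a pair_pre_digraph"
  assumes "n \<ge> 2" and "infinite_regular_tree n T"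
  shows "distance_regular T (\<lambda>i. if i = 0 then n else n - 1) (\<lambda>i. 1) \<and> graph_diam T = \<infinity>"
proof -
  have T: "pair_bidirected_digraph T" "connected (with_proj T)" "acyclic_graph T"
    and deg: "\<And>v. v \<in> pverts T \<Longrightarrow> out_degree (with_proj T) v = n"
    using assms(2) by (auto simp: infinite_regular_tree_def)
  interpret pair_tree T
    using T by (simp add: pair_tree_def pair_forest_def pair_forest_axioms_def pair_tree_axioms_def)
  have diam: "graph_diam T = \<infinity>"
    using deg assms(1) by (intro graph_diam_infinite) simp
  have "card (graph_sphere T (i + 1) v \<inter> graph_sphere T 1 w) = n - 1 \<and>
      card (graph_sphere T (i - 1) v \<inter> graph_sphere T 1 w) = 1"
    if "1 \<le> i" "v \<in> pverts T" "w \<in> pverts T" "graph_dist T v w = ereal (real i)" for i v w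
    using card_sphere_inter_neighbours[of v w i] that deg by (simp add: graph_sphere_def)
  \<comment> \<open>As the diameter is infinite, the counts are demanded for every
    \<open>i \<ge> 1\<close>, as just established; \<open>n \<ge> 2\<close> makes \<open>n\<close>
    and \<open>n - 1\<close> positive.\<close>
  with T(1,2) assms(1) deg diam show ?thesis
    unfolding distance_regular_def by (simp add: card_graph_sphere_1 del: One_nat_def)
qed

end
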